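(* Let $k>0$ be an even integer. Let $f=\sum_{n>0}a_n(f)q^n\in S_k(SL_2(\mathbb{Z}))$ be a newform of weight $k$ and level $1$ with $a_n(f)\in\mathbb{Z}$ for all $n$. Suppose $|a_2(f)|\neq 2^{k/2}$ and $|a_3(f)|\neq 3^{k/2}$. Then the smallest $n\ge 1$ for which $a_n(f)=0$ is a prime; that is, if the set $\{n\ge 1: a_n(f)=0\}$ is nonempty, then its least element is a prime number.
   Context: Here $q=e^{2\pi i z}$, $S_k(SL_2(\mathbb{Z}))$ is the space of cusp forms of weight $k$ for $SL_2(\mathbb{Z})$ (level $1$), and a newform of level $1$ is a Hecke eigenform in this space normalized so that $a_1(f)=1$. *)

theory Defs
  imports "HOL-Complex_Analysis.Complex_Analysis" "HOL-Computational_Algebra.Primes"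
begin

text \<open>
  Modular objects are total functions on \<^typ>\<open>complex\<close> of which only the restriction to the upper
  half-plane is relevant; no condition below looks at values outside it.
\<close>

definition upper_half_plane :: "complex set"
  where "upper_half_plane = {z. Im z > 0}"

definition has_q_expansion :: "(complex \<Rightarrow> complex) \<Rightarrow> (nat \<Rightarrow> complex) \<Rightarrow> bool"
  where "has_q_expansion f a \<longleftrightarrow>
    (\<forall>z\<in>upper_half_plane. (\<lambda>n. a n * exp (2 * of_real pi * \<i> * z) ^ n) sums f z)"

text \<open>The coefficients are determined by \<open>f\<close>, so the description in \<open>q_coeff\<close> below is proper.\<close>

lemma has_q_expansion_unique:
  assumes "has_q_expansion f a" "has_q_expansion f b"
  shows "a = b"
proof -
  define c where "c n = a n - b n" for n
  have s0: "(\<lambda>n. c n * w ^ n) sums 0" if "w \<noteq> 0" "norm w < 1" for w :: complex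
  proof -
    define z where "z = Ln w / (2 * of_real pi * \<i>)"
    have "exp (2 * of_real pi * \<i> * z) = w"
      using that by (simp add: z_def)
    moreover have "Im z = - ln (norm w) / (2 * pi)"
      using that by (simp add: z_def Im_divide power2_eq_square)
    hence "z \<in> upper_half_plane"
      using that by (simp add: upper_half_plane_def divide_neg_pos)
    ultimately have "(\<lambda>n. a n * w ^ n - b n * w ^ n) sums (f z - f z)"
      using assms unfolding has_q_expansion_def by (intro sums_diff) metis+
    thus ?thesis by (simp add: c_def algebra_simps)
  qed
  have "((\<lambda>_. 0) \<longlongrightarrow> c 0) (at (0::complex))"
    by (rule powser_limit_0_strong[of 1]) (use s0 in auto)
  hence c0: "c 0 = 0"
    using LIM_const_eq by metis
  have s: "(\<lambda>n. c n * w ^ n) sums 0" if "norm w < 1" for w :: complex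
    using s0[of w] that c0 powser_sums_zero[of c] by (cases "w = 0") auto
  have "c n = 0" for n
  proof (rule ccontr)
    assume nz: "c n \<noteq> 0"
    hence "n > 0" using c0 by (metis gr0I)
    show False
    proof (rule powser_0_nonzero[of 1 0 c "\<lambda>_. 0" n])
      show "(\<lambda>n. c n * (w - 0) ^ n) sums 0" if "norm (w - 0) < 1" for w
        using s that by simp
      show False
        if r: "r > 0" "\<And>w. w \<in> cball (0::complex) r - {0} \<Longrightarrow> (0::complex) \<noteq> 0" for r :: real
        using r(2)[of "of_real r"] r(1) by simp
    qed (use nz \<open>n > 0\<close> in simp_all)
  qed
  thus ?thesis by (auto simp: c_def)
qed

definition q_coeff :: "(complex \<Rightarrow> complex) \<Rightarrow> nat \<Rightarrow> complex"
  where "q_coeff f = (THE a. has_q_expansion f a)"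

lemma q_coeff_eqI: "has_q_expansion f a \<Longrightarrow> q_coeff f = a"
  unfolding q_coeff_def using has_q_expansion_unique by blast

text \<open>
  The space \<open>S\<^sub>k(SL\<^sub>2(\<int>))\<close>. The integers \<open>a, b, c, d\<close> are the entries of a matrix in
  \<open>SL\<^sub>2(\<int>)\<close>. The last clause says that \<open>f\<close> is holomorphic at the only cusp (no negative powers
  of \<open>q\<close>) and vanishes there.
\<close>

definition cusp_forms :: "nat \<Rightarrow> (complex \<Rightarrow> complex) set"
  where "cusp_forms k = {f.
    f holomorphic_on upper_half_plane \<and>
    (\<forall>a b c d :: int. a * d - b * c = 1 \<longrightarrow>
      (\<forall>z\<in>upper_half_plane.
        f ((of_int a * z + of_int b) / (of_int c * z + of_int d)) =
          (of_int c * z + of_int d) ^ k * f z)) \<and>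
    (\<exists>a. has_q_expansion f a \<and> a 0 = 0)}"

text \<open>
  The level one Hecke operator \<open>T\<^sub>n\<close> in weight \<open>k\<close>, with the usual normalization (for which the
  eigenvalue of a normalized eigenform is its \<open>n\<close>-th coefficient): the integral matrices
  with rows \<open>(n/d, b)\<close> and \<open>(0, d)\<close>, where \<open>d\<close> divides \<open>n\<close> and \<open>0 \<le> b < d\<close>, represent
  the orbits of left multiplication by \<open>SL\<^sub>2(\<int>)\<close> on the integral matrices of determinant \<open>n\<close>.
\<close>

definition hecke_op :: "nat \<Rightarrow> nat \<Rightarrow> (complex \<Rightarrow> complex) \<Rightarrow> complex \<Rightarrow> complex"
  where "hecke_op k n f z =
    of_nat n powi (int k - 1) *
      (\<Sum>d | d dvd n. \<Sum>b<d. f ((of_nat (n div d) * z + of_nat b) / of_nat d) / of_nat d ^ k)"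

definition hecke_eigenform :: "nat \<Rightarrow> (complex \<Rightarrow> complex) \<Rightarrow> bool"
  where "hecke_eigenform k f \<longleftrightarrow>
    f \<in> cusp_forms k \<and>
    (\<exists>z\<in>upper_half_plane. f z \<noteq> 0) \<and>
    (\<forall>n\<ge>1. \<exists>ev. \<forall>z\<in>upper_half_plane. hecke_op k n f z = ev * f z)"

definition newform :: "nat \<Rightarrow> (complex \<Rightarrow> complex) \<Rightarrow> bool"
  where "newform k f \<longleftrightarrow> hecke_eigenform k f \<and> q_coeff f 1 = 1"

end

theory Submission
  imports Defs
begin

text \<open>
  Comparing \<open>q\<close>-expansions in \<open>T\<^sub>n f = a\<^sub>n f\<close> gives the Hecke relations, so the least zero
  is a prime power \<open>p\<^sup>r\<close> and \<open>u\<^sub>s = a(p\<^sup>s)\<close> is a Lucas sequence with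
  parameters \<open>x = a\<^sub>p\<close> and \<open>P = p ^ (k - 1)\<close>. Suppose \<open>r > 1\<close>, so \<open>x \<noteq> 0\<close>. If \<open>p ^ (k / 2)\<close>
  does not divide \<open>x\<close>, then \<open>P\<close> has larger \<open>p\<close>-adic valuation than \<open>x\<^sup>2\<close>, the leading term
  \<open>x\<^sup>s\<close> dominates \<open>u\<^sub>s\<close> \<open>p\<close>-adically, and no \<open>u\<^sub>s\<close> vanishes. If \<open>x\<^sup>2 \<ge> 4 P\<close>, the
  characteristic roots are real of equal sign, and again no \<open>u\<^sub>s\<close> vanishes. Hence
  \<open>x = p ^ (k / 2) * c\<close> with \<open>p * c\<^sup>2 < 4\<close>, which leaves only \<open>p \<in> {2, 3}\<close> and \<open>c = \<plusminus>1\<close>.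
\<close>

section \<open>Hecke operators on \<open>q\<close>-expansions and the Hecke relations\<close>

lemma sum_unit_roots_power:
  fixes d m :: nat
  assumes "d > 0"
  shows "(\<Sum>b<d. exp (2 * of_real pi * \<i> * (of_nat m * of_nat b / of_nat d))) =
    (if d dvd m then of_nat d else (0::complex))"
proof -
  define w where "w = exp (2 * of_real pi * \<i> * of_nat m / of_nat d)"
  have "w ^ d = 1"
    using assms exp_integer_2pi[of "of_nat m"]
    by (simp add: w_def exp_of_nat_mult [symmetric] mult_ac)
  moreover have "w = 1 \<longleftrightarrow> d dvd m"
    using assms complex_root_unity_eq_1[of d m] by (simp add: w_def mult_ac)
  moreover have "exp (2 * of_real pi * \<i> * (of_nat m * of_nat b / of_nat d)) = w ^ b" for b
    by (simp add: w_def exp_of_nat_mult [symmetric] mult_ac)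
  ultimately show ?thesis
    by (simp add: sum_gp_strict)
qed

text \<open>Averaging over \<open>b\<close> kills every index not divisible by \<open>d\<close>, by
  orthogonality of roots of unity; the surviving index \<open>d * i\<close> carries
  \<open>q ^ (e * i)\<close>. Indexing by the exponent \<open>j\<close> of \<open>q\<close> lets the
  series for different \<open>d\<close> be added termwise.\<close>

lemma hecke_summand_sums:
  assumes f: "has_q_expansion f a" and z: "z \<in> upper_half_plane"
    and d: "d > 0" and e: "e > 0"
  shows "(\<lambda>j. if e dvd j then a (d * (j div e)) * exp (2 * of_real pi * \<i> * z) ^ j else 0) sums
    ((\<Sum>b<d. f ((of_nat e * z + of_nat b) / of_nat d)) / of_nat d)"
proof -
  define q where "q = exp (2 * of_real pi * \<i> * z)"
  define W where "W = exp (2 * of_real pi * \<i> * (of_nat e * z / of_nat d))"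
  define S where "S = (\<Sum>b<d. f ((of_nat e * z + of_nat b) / of_nat d))"
  have "(\<lambda>m. \<Sum>b<d. a m * exp (2 * of_real pi * \<i> * ((of_nat e * z + of_nat b) / of_nat d)) ^ m)
      sums S"
    unfolding S_def
  proof (rule sums_sum)
    fix b
    have "(of_nat e * z + of_nat b) / of_nat d \<in> upper_half_plane"
      using z d e by (simp add: upper_half_plane_def)
    thus "(\<lambda>m. a m * exp (2 * of_real pi * \<i> * ((of_nat e * z + of_nat b) / of_nat d)) ^ m)
        sums f ((of_nat e * z + of_nat b) / of_nat d)"
      using f unfolding has_q_expansion_def by blast
  qed
  also have "(\<lambda>m. \<Sum>b<d. a m * exp (2 * of_real pi * \<i> * ((of_nat e * z + of_nat b) / of_nat d)) ^ m)
    = (\<lambda>m. if d dvd m then of_nat d * (a m * W ^ m) else 0)"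
  proof
    fix m
    have "exp (2 * of_real pi * \<i> * ((of_nat e * z + of_nat b) / of_nat d)) ^ m =
        W ^ m * exp (2 * of_real pi * \<i> * (of_nat m * of_nat b / of_nat d))" for b
      by (simp add: W_def exp_of_nat_mult [symmetric] exp_add [symmetric]
          add_divide_distrib algebra_simps)
    hence "(\<Sum>b<d. a m * exp (2 * of_real pi * \<i> * ((of_nat e * z + of_nat b) / of_nat d)) ^ m)
      = a m * W ^ m * (\<Sum>b<d. exp (2 * of_real pi * \<i> * (of_nat m * of_nat b / of_nat d)))"
      by (simp add: sum_distrib_left mult.assoc)
    thus "(\<Sum>b<d. a m * exp (2 * of_real pi * \<i> * ((of_nat e * z + of_nat b) / of_nat d)) ^ m)
      = (if d dvd m then of_nat d * (a m * W ^ m) else 0)"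
      using sum_unit_roots_power[OF d] by simp
  qed
  finally have "(\<lambda>m. if d dvd m then of_nat d * (a m * W ^ m) else 0) sums S" .
  \<comment> \<open>Restricting to \<open>m = d * i\<close> drops only zero terms; the last
    reindexing runs the other way and spreads the series over all exponents \<open>j\<close>, with
    support on \<open>j = e * i\<close>.\<close>
  hence "(\<lambda>i. if d dvd d * i then of_nat d * (a (d * i) * W ^ (d * i)) else 0) sums S"
    using d by (subst sums_mono_reindex) (auto simp: strict_mono_def)
  moreover have "W ^ (d * i) = q ^ (e * i)" for i
    using d by (simp add: W_def q_def exp_of_nat_mult [symmetric] mult_ac)
  ultimately have "(\<lambda>i. of_nat d * (a (d * i) * q ^ (e * i))) sums S"
    by simp
  hence "(\<lambda>i. of_nat d * (a (d * i) * q ^ (e * i)) / of_nat d) sums (S / of_nat d)"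
    by (rule sums_divide)
  hence "(\<lambda>i. if e dvd e * i then a (d * (e * i div e)) * q ^ (e * i) else 0) sums (S / of_nat d)"
    using d e by simp
  thus ?thesis
    unfolding q_def [symmetric] S_def [symmetric]
    using e by (subst (asm) sums_mono_reindex) (auto simp: strict_mono_def)
qed

text \<open>The substitution \<open>e = n div d\<close> turns the sum over divisors in
  \<open>hecke_op\<close> into the classical sum over common divisors of \<open>n\<close> and
  \<open>m\<close>.\<close>

lemma has_q_expansion_hecke_op:
  assumes f: "has_q_expansion f a" and k: "k > 0" and n: "n > 0"
  shows "has_q_expansion (hecke_op k n f)
    (\<lambda>m. \<Sum>e | e dvd n \<and> e dvd m. of_nat e ^ (k - 1) * a (m * n div e\<^sup>2))"
  unfolding has_q_expansion_def
proof
  fix z assume z: "z \<in> upper_half_plane"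
  define q where "q = exp (2 * of_real pi * \<i> * z)"
  define S where "S d = (\<Sum>b<d. f ((of_nat (n div d) * z + of_nat b) / of_nat d))" for d
  have "(\<lambda>j. \<Sum>d | d dvd n. of_nat (n div d) ^ (k - 1) *
      (if n div d dvd j then a (d * (j div (n div d))) * q ^ j else 0)) sums
    (\<Sum>d | d dvd n. of_nat (n div d) ^ (k - 1) * (S d / of_nat d))"
    unfolding q_def S_def using n
    by (intro sums_sum sums_mult hecke_summand_sums[OF f z])
       (auto simp: dvd_pos_nat dvd_div_eq_0_iff intro!: Nat.gr0I)
  moreover have "(\<Sum>d | d dvd n. of_nat (n div d) ^ (k - 1) * (S d / of_nat d)) = hecke_op k n f z"
  proof -
    \<comment> \<open>The weight n^(k-1) / d^k is split as (n/d)^(k-1) / d, leaving the factor 1/d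
      of the average over \<open>b\<close>.\<close>
    have "of_nat (n div d) ^ (k - 1) * (S d / of_nat d)
        = of_nat n ^ (k - 1) * (S d / of_nat d ^ k)" if "d dvd n" for d
    proof -
      have "d > 0" using that n by (auto intro: Nat.gr0I)
      moreover have "of_nat d ^ k = (of_nat d * of_nat d ^ (k - 1) :: complex)"
        using k by (cases k) auto
      ultimately show ?thesis
        using power_mult_distrib[of "of_nat d" "of_nat (n div d) :: complex" "k - 1"] that
        by (simp add: field_simps flip: of_nat_mult)
    qed
    moreover have "of_nat n powi (int k - 1) = (of_nat n ^ (k - 1) :: complex)"
      using k by (simp add: power_int_def nat_diff_distrib)
    ultimately show ?thesis
      by (simp add: hecke_op_def S_def sum_distrib_left sum_divide_distrib)
  qed
  moreover have "(\<Sum>d | d dvd n. of_nat (n div d) ^ (k - 1) *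
      (if n div d dvd j then a (d * (j div (n div d))) * q ^ j else 0)) =
    (\<Sum>e | e dvd n \<and> e dvd j. of_nat e ^ (k - 1) * a (j * n div e\<^sup>2)) * q ^ j" for j
  proof -
    have "(\<Sum>d | d dvd n. of_nat (n div d) ^ (k - 1) *
        (if n div d dvd j then a (d * (j div (n div d))) * q ^ j else 0)) =
      (\<Sum>e | e dvd n. of_nat e ^ (k - 1) *
        (if e dvd j then a ((n div e) * (j div e)) * q ^ j else 0))"
      using n by (intro sum.reindex_bij_witness[of _ "\<lambda>d. n div d" "\<lambda>d. n div d"]) auto
    also have "\<dots> = (\<Sum>e | e dvd n \<and> e dvd j.
        of_nat e ^ (k - 1) * (a ((n div e) * (j div e)) * q ^ j))"
      using n by (intro sum.mono_neutral_cong_right) auto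
    also have "\<dots> = (\<Sum>e | e dvd n \<and> e dvd j. of_nat e ^ (k - 1) * (a (j * n div e\<^sup>2) * q ^ j))"
      by (intro sum.cong refl) (auto simp: power2_eq_square div_mult_div_if_dvd mult.commute)
    finally show ?thesis
      by (simp add: sum_distrib_right mult.assoc)
  qed
  ultimately show "(\<lambda>j. (\<Sum>e | e dvd n \<and> e dvd j. of_nat e ^ (k - 1) * a (j * n div e\<^sup>2)) *
      exp (2 * of_real pi * \<i> * z) ^ j) sums hecke_op k n f z"
    by (simp add: q_def)
qed

text \<open>Uniqueness of \<open>q\<close>-expansions turns the eigenvalue equation into identities
  of coefficients, and the one at index 1 identifies the eigenvalue.\<close>

lemma newform_coeff_mult:
  assumes nf: "newform k f" and k: "k > 0" and n: "n > 0"
  shows "q_coeff f n * q_coeff f m =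
    (\<Sum>e | e dvd n \<and> e dvd m. of_nat e ^ (k - 1) * q_coeff f (m * n div e\<^sup>2))"
proof -
  have f: "has_q_expansion f (q_coeff f)"
    using nf q_coeff_eqI by (auto simp: newform_def hecke_eigenform_def cusp_forms_def)
  obtain ev where ev: "\<And>z. z \<in> upper_half_plane \<Longrightarrow> hecke_op k n f z = ev * f z"
    using nf n unfolding newform_def hecke_eigenform_def
    by (metis One_nat_def Suc_leI)
  have "has_q_expansion (hecke_op k n f) (\<lambda>m. ev * q_coeff f m)"
    using f ev by (auto simp: has_q_expansion_def mult.assoc intro: sums_mult)
  from has_q_expansion_unique[OF this has_q_expansion_hecke_op[OF f k n]]
  have rel: "ev * q_coeff f m =
      (\<Sum>e | e dvd n \<and> e dvd m. of_nat e ^ (k - 1) * q_coeff f (m * n div e\<^sup>2))" for m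
    by (rule fun_cong)
  \<comment> \<open>At \<open>m = 1\<close> only \<open>e = 1\<close> contributes; the simplifier
    rewrites \<open>e dvd 1\<close> to \<open>e = Suc 0\<close>.\<close>
  have "{e. e dvd n \<and> e = Suc 0} = {1}" by auto
  hence "ev = q_coeff f n"
    using rel[of 1] nf by (simp add: newform_def)
  thus ?thesis using rel by simp
qed

lemma newform_coeff_coprime:
  assumes "newform k f" "k > 0" "n > 0" "coprime n m"
  shows "q_coeff f (n * m) = q_coeff f n * q_coeff f m"
proof -
  have "{e. e dvd n \<and> e dvd m} = {1}"
    using assms(4) by (auto dest: coprime_common_divisor)
  thus ?thesis
    using newform_coeff_mult[OF assms(1-3), of m] by (simp add: mult.commute)
qed

lemma newform_coeff_prime_power:
  assumes "newform k f" "k > 0" "prime p"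
  shows "q_coeff f (p ^ Suc (Suc r)) =
    q_coeff f p * q_coeff f (p ^ Suc r) - of_nat p ^ (k - 1) * q_coeff f (p ^ r)"
proof -
  have p: "p > 1" using assms(3) by (rule prime_gt_1_nat)
  have "{e. e dvd p \<and> e dvd p ^ Suc r} = {1, p}"
    using assms(3) p by (auto simp: prime_nat_iff)
  moreover have "p ^ Suc r * p div p\<^sup>2 = p ^ r"
    using p by (simp add: power2_eq_square)
  ultimately show ?thesis
    using newform_coeff_mult[OF assms(1,2), of p "p ^ Suc r"] p
    by (simp add: mult_ac)
qed

section \<open>Zeros of Lucas sequences\<close>

lemma lucas_real_nonzero:
  fixes u :: "nat \<Rightarrow> int"
  assumes u: "u 0 = 1" "u (Suc 0) = x" "\<And>r. u (Suc (Suc r)) = x * u (Suc r) - P * u r"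
    and x: "x \<noteq> 0" and P: "x\<^sup>2 \<ge> 4 * P" "P \<ge> 0"
  shows "u r \<noteq> 0"
proof -
  text \<open>Replacing \<open>u r\<close> by \<open>u r * x ^ r\<close> makes the claim independent of the sign of \<open>x\<close>.\<close>
  define v where "v r = u r * x ^ r" for r
  have rec: "v (Suc (Suc r)) = x\<^sup>2 * (v (Suc r) - P * v r)" for r
    by (simp add: v_def u(3) algebra_simps power2_eq_square)
  have x2: "x\<^sup>2 > 0" using x by simp
  \<comment> \<open>The ratio of consecutive terms stays at least x^2 / 2: a ratio t is followed by
    x^2 (1 - P/t), and P/t \<le> 2 P / x^2 \<le> 1/2.\<close>
  have "v r > 0 \<and> 2 * v (Suc r) \<ge> x\<^sup>2 * v r" for r
  proof (induction r)
    case 0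
    show ?case using x2 by (simp add: v_def u power2_eq_square)
  next
    case (Suc r)
    have "2 * v (Suc r) > 0"
      using Suc x2 by (smt (verit) mult_pos_pos)
    moreover have "4 * P * v r \<le> x\<^sup>2 * v r"
      using Suc P by (intro mult_right_mono) auto
    hence "2 * (v (Suc r) - P * v r) \<ge> v (Suc r)"
      using conjunct2[OF Suc] unfolding mult.assoc right_diff_distrib by linarith
    hence "x\<^sup>2 * (2 * (v (Suc r) - P * v r)) \<ge> x\<^sup>2 * v (Suc r)"
      using x2 by (intro mult_left_mono) auto
    ultimately show ?case by (simp add: rec algebra_simps)
  qed
  thus ?thesis by (metis v_def mult_zero_left less_irrefl)
qed

text \<open>The valuation of \<open>u r\<close> is exactly \<open>r * s\<close>: in the recurrence,
  \<open>x * u (Suc r)\<close> has valuation \<open>(r + 2) * s\<close>, while that of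
  \<open>P * u r\<close> is larger by at least one.\<close>

lemma lucas_padic_nonzero:
  fixes u :: "nat \<Rightarrow> int"
  assumes u: "u 0 = 1" "u (Suc 0) = x" "\<And>r. u (Suc (Suc r)) = x * u (Suc r) - P * u r"
    and p: "prime p" and x: "x = p ^ s * y" "\<not> p dvd y" and P: "P = p ^ (2 * s + 1) * t"
  shows "u r \<noteq> 0"
proof -
  have "\<exists>v w. u r = p ^ (r * s) * v \<and> \<not> p dvd v \<and> u (Suc r) = p ^ (Suc r * s) * w \<and> \<not> p dvd w"
  proof (induction r)
    case 0
    show ?case using x p by (auto simp: u)
  next
    case (Suc r)
    then obtain v w where vw: "u r = p ^ (r * s) * v" "u (Suc r) = p ^ (Suc r * s) * w" "\<not> p dvd w"
      by blast
    have "u (Suc (Suc r)) = p ^ (Suc (Suc r) * s) * (y * w - p * (t * v))"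
      unfolding u(3) vw x P by (simp add: algebra_simps power_add mult_2_right)
    moreover have "\<not> p dvd y * w - p * (t * v)"
      using vw x p by (simp add: prime_dvd_mult_iff dvd_diff_left_iff)
    ultimately show ?case using vw by blast
  qed
  then obtain v where "u r = p ^ (r * s) * v" "\<not> p dvd v" by blast
  thus ?thesis using p by auto
qed

lemma lucas_zero_imp:
  fixes u :: "nat \<Rightarrow> int"
  assumes u: "u 0 = 1" "u (Suc 0) = x"
      "\<And>r. u (Suc (Suc r)) = x * u (Suc r) - p ^ (2 * h - 1) * u r"
    and p: "prime p" and h: "h > 0" and x: "x \<noteq> 0" and r: "u r = 0"
  shows "(p = 2 \<or> p = 3) \<and> \<bar>x\<bar> = p ^ h"
proof -
  have p2: "p \<ge> 2" using p by (rule prime_ge_2_int)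
  have "\<not> is_unit p" using p by auto
  with x obtain y where y: "x = p ^ multiplicity p x * y" "\<not> p dvd y"
    using multiplicity_decompose' by metis
  have "multiplicity p x \<ge> h"
  proof (rule ccontr)
    assume "\<not> ?thesis"
    \<comment> \<open>The odd exponent \<open>2 * h - 1\<close> is at least \<open>2 * s + 1\<close>
      as soon as \<open>s < h\<close>, so no subtraction is truncated.\<close>
    hence "2 * h - 1 = (2 * multiplicity p x + 1) + (2 * h - 2 - 2 * multiplicity p x)" by simp
    hence "p ^ (2 * h - 1) =
        p ^ (2 * multiplicity p x + 1) * p ^ (2 * h - 2 - 2 * multiplicity p x)"
      by (metis power_add)
    from lucas_padic_nonzero[OF u p y this] r show False by blast
  qed
  then obtain c where c: "x = p ^ h * c"
    using multiplicity_dvd' by (metis dvd_def)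
  have "x\<^sup>2 < 4 * p ^ (2 * h - 1)"
    using lucas_real_nonzero[OF u x, of r] r p2 by force
  moreover have "p ^ (2 * h) = p * p ^ (2 * h - 1)"
    using h by (cases h) auto
  hence "x\<^sup>2 = (p * c\<^sup>2) * p ^ (2 * h - 1)"
    by (simp add: c power_mult_distrib power_mult [symmetric] mult_ac)
  ultimately have pc: "p * c\<^sup>2 < 4"
    using p2 by simp
  have "c \<noteq> 0" using c x by auto
  hence c1: "c\<^sup>2 \<ge> 1" using zero_less_power2[of c] by linarith
  have "p * 1 \<le> p * c\<^sup>2" using c1 p2 by (intro mult_left_mono) auto
  hence "p = 2 \<or> p = 3" using pc p2 by linarith
  moreover have "2 * c\<^sup>2 \<le> p * c\<^sup>2" using p2 by (intro mult_right_mono) auto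
  hence "c\<^sup>2 = 1" using pc c1 by linarith
  hence "\<bar>c\<bar> = 1" by (simp add: power2_eq_1_iff) linarith
  hence "\<bar>x\<bar> = p ^ h" using p2 by (simp add: c abs_mult)
  ultimately show ?thesis by blast
qed

theorem theorem2p1:
  fixes k :: nat and f :: "complex \<Rightarrow> complex"
  assumes "k > 0" and "even k"
    and "newform k f"
    and "\<forall>n\<ge>1. q_coeff f n \<in> \<int>"
    and "cmod (q_coeff f 2) \<noteq> 2 ^ (k div 2)"
    and "cmod (q_coeff f 3) \<noteq> 3 ^ (k div 2)"
  shows "{n. n \<ge> 1 \<and> q_coeff f n = 0} \<noteq> {} \<longrightarrow>
    prime (LEAST n. n \<ge> 1 \<and> q_coeff f n = 0)"
proof
  assume ne: "{n. n \<ge> 1 \<and> q_coeff f n = 0} \<noteq> {}"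
  define N where "N = (LEAST n. n \<ge> 1 \<and> q_coeff f n = 0)"
  have N: "N \<ge> 1" "q_coeff f N = 0"
    using LeastI_ex[of "\<lambda>n. n \<ge> 1 \<and> q_coeff f n = 0"] ne by (auto simp: N_def)
  have small: "q_coeff f n \<noteq> 0" if "n \<ge> 1" "n < N" for n
    using not_less_Least[of n "\<lambda>n. n \<ge> 1 \<and> q_coeff f n = 0"] that by (auto simp: N_def)
  have one: "q_coeff f 1 = 1"
    using assms(3) by (simp add: newform_def)
  hence "N \<noteq> 1" using N by auto
  then obtain p where p: "prime p" "p dvd N"
    using prime_factor_nat by blast
  have p1: "p > 1" using p(1) by (rule prime_gt_1_nat)
  obtain c where c: "N = p ^ multiplicity p N * c" "\<not> p dvd c"
    using multiplicity_decompose'[of N p] N p1 by auto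
  define r where "r = multiplicity p N"
  have r: "r > 0"
    using p N by (auto simp: r_def prime_multiplicity_gt_zero_iff)
  \<comment> \<open>Otherwise \<open>N\<close> is a product of two smaller coprime factors, and by
    multiplicativity the coefficient at one of them vanishes already.\<close>
  have "c = 1"
  proof (rule ccontr)
    assume "c \<noteq> 1"
    moreover have "c > 0" using c N by (auto intro: Nat.gr0I)
    ultimately have c1: "c > 1" by simp
    have "p ^ r > 1" using p1 r by (rule one_less_power)
    hence "c < N" "p ^ r < N"
      using c(1) c1 p1 by (auto simp: r_def [symmetric])
    moreover have "q_coeff f (p ^ r * c) = q_coeff f (p ^ r) * q_coeff f c"
      using assms p c p1
      by (intro newform_coeff_coprime[of k])
         (auto intro!: coprime_power_left_iff [THEN iffD2] simp: prime_imp_coprime)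
    ultimately show False
      using small N c c1 \<open>p ^ r > 1\<close> by (auto simp: r_def [symmetric])
  qed
  hence Np: "N = p ^ r" using c by (simp add: r_def)
  \<comment> \<open>If \<open>r > 1\<close>, then \<open>p < N\<close>, so minimality makes the
    Lucas parameter \<open>q_coeff f p\<close> nonzero.\<close>
  have "r = 1"
  proof (rule ccontr)
    assume "r \<noteq> 1"
    hence "p ^ 1 < p ^ r" using r p1 by (intro power_strict_increasing) auto
    hence ap: "q_coeff f p \<noteq> 0" using small p1 Np by simp
    have "\<exists>i. q_coeff f (p ^ s) = of_int i" for s
      using assms(4) p1 by (metis Ints_cases Suc_leI zero_less_power One_nat_def gr_implies_not0 not_gr_zero)
    then obtain u where u: "\<And>s. q_coeff f (p ^ s) = of_int (u s)" by metis
    \<comment> \<open>Evenness of \<open>k\<close> gives \<open>k - 1\<close> the form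
      \<open>2 * h - 1\<close> with \<open>h = k div 2\<close>.\<close>
    have k: "2 * (k div 2) = k" using assms(2) by simp
    have 1: "u 0 = 1" using u[of 0] one by simp
    have 2: "u (Suc (Suc s)) = u (Suc 0) * u (Suc s) - int p ^ (2 * (k div 2) - 1) * u s" for s
    proof -
      have "(of_int (u (Suc (Suc s))) :: complex) =
          of_int (u (Suc 0) * u (Suc s) - int p ^ (k - 1) * u s)"
        using newform_coeff_prime_power[OF assms(3,1) p(1), of s] u[of "Suc 0"]
        by (simp add: u [symmetric] del: power_Suc)
      thus ?thesis unfolding k by (simp only: of_int_eq_iff)
    qed
    have "(int p = 2 \<or> int p = 3) \<and> \<bar>u (Suc 0)\<bar> = int p ^ (k div 2)"
    proof (rule lucas_zero_imp[of u "u (Suc 0)" "int p" "k div 2" r])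
      show "k div 2 > 0" using assms(1,2) by auto
      show "u (Suc 0) \<noteq> 0" using u[of "Suc 0"] ap by auto
      show "u r = 0" using u[of r] N Np by auto
    qed (use 1 2 p in auto)
    moreover have "cmod (q_coeff f p) = of_int \<bar>u (Suc 0)\<bar>"
      using u[of "Suc 0"] by simp
    ultimately show False using assms(5,6) by auto
  qed
  thus "prime (LEAST n. n \<ge> 1 \<and> q_coeff f n = 0)"
    using Np p by (simp add: N_def)
qed

end
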